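(* Let $D=\langle L,\oplus,\otimes,\bot,\top\rangle$ be an annotation domain and let $G$ be an annotated graph over $D$. The proof system $\vdash$ is sound and complete for $\models$; that is, for every annotated triple $\tau:\lambda$: (1) if $G\vdash\tau:\lambda$ then $G\models\tau:\lambda$; and (2) if $G\models\tau:\lambda$ then there is $\lambda'\succeq\lambda$ with $G\vdash\tau:\lambda'$.
   Context: **Annotation domain.** A tuple $D=\langle L,\oplus,\otimes,\bot,\top\rangle$ with $L$ a non-empty set, $\bot,\top\in L$, such that: $\oplus$ is idempotent, commutative, associative; $\otimes$ is commutative and associative; $\bot\oplus\lambda=\lambda$, $\top\otimes\lambda=\lambda$, $\bot\otimes\lambda=\bot$, $\top\oplus\lambda=\top$ for all $\lambda\in L$; and $\otimes$ distributes over $\oplus$. Its induced partial order is $\lambda_1\preceq\lambda_2$ iff $\lambda_1\oplus\lambda_2=\lambda_2$. **Syntax.** $\mathbf U,\mathbf B,\mathbf L$ are fixed pairwise disjoint infinite alphabets of URI references, blank nodes (also called variables) and literals (some of the literals are called plain literals); concatenation of names denotes union. An RDF triple is $(s,p,o)\in\mathbf{UBL}\times\mathbf U\times\mathbf{UBL}$. An annotated triple is $\tau:\lambda$ with $\tau$ an RDF triple and $\lambda\in L$, $\lambda\neq\bot$ (triples annotated with $\bot$ are not considered part of the language). An annotated graph is a finite set of annotated triples; it is ground if no blank node occurs in it. $universe(G)$ is the set of elements of $\mathbf{UBL}$ occurring in the triples of $G$. $\rho\mathrm{df}=\{\mathsf{sp},\mathsf{sc},\mathsf{type},\mathsf{dom},\mathsf{range}\}\subseteq\mathbf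 U$. A map is a function $\mu:\mathbf{UBL}\to\mathbf{UBL}$ with $\mu(t)=t$ for $t\in\mathbf{UL}$; $\mu(G)$ applies $\mu$ to subjects, predicates and objects, keeping annotations; $\mu:G'\to G$ means $\mu(G')\subseteq G$. **Interpretations.** An annotated interpretation over a vocabulary $V$ is $\mathcal I=\langle\Delta_R,\Delta_P,\Delta_C,\Delta_L,P[\![\cdot]\!],C[\![\cdot]\!],\cdot^{\mathcal I}\rangle$ where: $\Delta_R$ is a nonempty finite set; $\Delta_P$ is a finite set (not necessarily disjoint from $\Delta_R$); $\Delta_C\subseteq\Delta_R$; $\Delta_L\subseteq\Delta_R$ contains all plain literals in $\mathbf L\cap V$; $P[\![\cdot]\!]$ maps each $p\in\Delta_P$ to a function $P[\![p]\!]:\Delta_R\times\Delta_R\to L$; $C[\![\cdot]\!]$ maps each $c\in\Delta_C$ to a function $C[\![c]\!]:\Delta_R\to L$; $\cdot^{\mathcal I}$ maps each $t\in\mathbf{UL}\cap V$ to $t^{\mathcal I}\in\Delta_R\cup\Delta_P$, is the identity on plain literals, and maps each literal into $\Delta_R$. The functions $P[\![e^{\mathcal I}]\!]$ for $e\in\rho\mathrm{df}$ may be partial, as specified under Typing II. **Models.** $\mathcal I$ is a model of a ground annotated graph $G$, written $\mathcal I\models G$, iff $\mathcal I$ interprets $\rho\mathrm{df}\cup universe(G)$ and satisfies the following (each inequality is required whenever its left-hand side is defined and different from $\bot$, and its right-hand side must then be defined): - Simple: $(s,p,o):\lambda\in G$ implies $p^{\mathcal I}\in\Delta_P$ and $P[\![p^{\mathcal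 I}]\!](s^{\mathcal I},o^{\mathcal I})\succeq\lambda$. - Subproperty: $P[\![\mathsf{sp}^{\mathcal I}]\!](p,q)\otimes P[\![\mathsf{sp}^{\mathcal I}]\!](q,r)\preceq P[\![\mathsf{sp}^{\mathcal I}]\!](p,r)$; $P[\![p]\!](x,y)\otimes P[\![\mathsf{sp}^{\mathcal I}]\!](p,q)\preceq P[\![q]\!](x,y)$. - Subclass: $P[\![\mathsf{sc}^{\mathcal I}]\!](c,d)\otimes P[\![\mathsf{sc}^{\mathcal I}]\!](d,e)\preceq P[\![\mathsf{sc}^{\mathcal I}]\!](c,e)$; $C[\![c]\!](x)\otimes P[\![\mathsf{sc}^{\mathcal I}]\!](c,d)\preceq C[\![d]\!](x)$. - Typing I: $C[\![c]\!](x)=P[\![\mathsf{type}^{\mathcal I}]\!](x,c)$ for $c\in\Delta_C$; $P[\![\mathsf{dom}^{\mathcal I}]\!](p,c)\otimes P[\![p]\!](x,y)\preceq C[\![c]\!](x)$; $P[\![\mathsf{range}^{\mathcal I}]\!](p,c)\otimes P[\![p]\!](x,y)\preceq C[\![c]\!](y)$. - Typing II: $e^{\mathcal I}\in\Delta_P$ for each $e\in\rho\mathrm{df}$; $P[\![\mathsf{sp}^{\mathcal I}]\!](p,q)$ is defined only for $p,q\in\Delta_P$; $P[\![\mathsf{sc}^{\mathcal I}]\!](c,d)$ only for $c,d\in\Delta_C$; $P[\![\mathsf{dom}^{\mathcal I}]\!](p,c)$ and $P[\![\mathsf{range}^{\mathcal I}]\!](p,c)$ only for $p\in\Delta_P$,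 $c\in\Delta_C$; $P[\![\mathsf{type}^{\mathcal I}]\!](s,c)$ only for $c\in\Delta_C$. (On these arguments from $\Delta_R$ they are defined.) **Entailment.** For ground graphs, $G\models H$ iff every model of $G$ (interpreting also the vocabulary of $H$) is a model of $H$. In general, $G\models H$ iff for every grounding $G'$ of $G$ there is a grounding $H'$ of $H$ with $G'\models H'$, where a grounding replaces blank nodes by terms of $\mathbf{UL}$. $G\models\tau:\lambda$ means $G\models\{\tau:\lambda\}$. **Proof system.** $G\vdash G'$ iff $G'$ can be obtained from $G$ by repeatedly applying the rules below; $G\vdash\tau:\lambda$ means $G\vdash\{\tau:\lambda\}$. Here $A,B,C,X,Y$ range over $\mathbf{UBL}$ and $D,E$ over $\mathbf{UL}$, and all expressions must be annotated triples. Rules 2–5 add the conclusion to the current graph when the premises are in it; rule 6 is destructive (it replaces its premises by its conclusion). A rule is not applied if its conclusion has annotation $\bot$. 1. (a) from $G$ infer $G'$ if there is a map $\mu:G'\to G$; (b) from $G$ infer $G'$ if $G'\subseteq G$. 2. (a) $(A,\mathsf{sp},B):\lambda_1,\ (B,\mathsf{sp},C):\lambda_2\ \Rightarrow\ (A,\mathsf{sp},C):\lambda_1\otimes\lambda_2$; (b) $(D,\mathsf{sp},E):\lambda_1,\ (X,D,Y):\lambda_2\ \Rightarrow\ (X,E,Y):\lambda_1\otimes\lambda_2$. 3. (a) $(A,\mathsf{sc},B):\lambda_1,\ (B,\mathsf{sc},C):\lambda_2\ \Rightarrow\ (A,\mathsf{sc},C):\lambda_1\otimes\lambda_2$; (b)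 $(A,\mathsf{sc},B):\lambda_1,\ (X,\mathsf{type},A):\lambda_2\ \Rightarrow\ (X,\mathsf{type},B):\lambda_1\otimes\lambda_2$. 4. (a) $(D,\mathsf{dom},B):\lambda_1,\ (X,D,Y):\lambda_2\ \Rightarrow\ (X,\mathsf{type},B):\lambda_1\otimes\lambda_2$; (b) $(D,\mathsf{range},B):\lambda_1,\ (X,D,Y):\lambda_2\ \Rightarrow\ (Y,\mathsf{type},B):\lambda_1\otimes\lambda_2$. 5. (a) $(A,\mathsf{dom},B):\lambda_1,\ (D,\mathsf{sp},A):\lambda_2,\ (X,D,Y):\lambda_3\ \Rightarrow\ (X,\mathsf{type},B):\lambda_1\otimes\lambda_2\otimes\lambda_3$; (b) $(A,\mathsf{range},B):\lambda_1,\ (D,\mathsf{sp},A):\lambda_2,\ (X,D,Y):\lambda_3\ \Rightarrow\ (Y,\mathsf{type},B):\lambda_1\otimes\lambda_2\otimes\lambda_3$. 6. $(X,A,Y):\lambda_1,\ (X,A,Y):\lambda_2\ \Rightarrow\ (X,A,Y):\lambda_1\oplus\lambda_2$. *)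

theory Defs
  imports "HOL-Library.Infinite_Typeclass"
begin

section \<open>Annotation domains\<close>

text \<open>
  An annotation domain is rendered as a type class; the carrier \<open>L\<close> is the whole type, and
  \<open>\<oplus>\<close>, \<open>\<otimes>\<close>, \<open>\<bottom>\<close>, \<open>\<top>\<close> are written \<open>+\<close>, \<open>*\<close>, \<open>0\<close>, \<open>1\<close>. The class
  \<^class>\<open>comm_semiring_0\<close> gives associativity and commutativity of \<open>\<oplus>\<close> and \<open>\<otimes>\<close>,
  \<open>\<bottom> \<oplus> x = x\<close>, \<open>\<bottom> \<otimes> x = \<bottom>\<close> and distributivity; \<^class>\<open>comm_monoid_mult\<close> gives
  \<open>\<top> \<otimes> x = x\<close>. The degenerate case \<open>\<bottom> = \<top>\<close> is not excluded.
\<close>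

class annotation_domain = comm_semiring_0 + comm_monoid_mult +
  assumes oplus_idem: "a + a = a"
    and top_oplus: "1 + a = 1"

definition ann_le :: "'a::annotation_domain \<Rightarrow> 'a \<Rightarrow> bool" (infix "\<preceq>" 50) where
  "a \<preceq> b \<longleftrightarrow> a + b = b"


section \<open>Syntax\<close>

text \<open>
  The five constants make up the rho-df vocabulary; the remaining URI references are the
  \<open>Ref u\<close>. For infinite \<open>'u\<close> this is an infinite alphabet with five distinguished elements.
\<close>

datatype 'u uri = Sp | Sc | Typ | Dom | Rng | Ref 'u

datatype ('u, 'b, 'l) rdf_term = URI "'u uri" | Blank 'b | Literal 'l

type_synonym ('u, 'b, 'l) triple =
  "('u, 'b, 'l) rdf_term \<times> 'u uri \<times> ('u, 'b, 'l) rdf_term"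

type_synonym ('u, 'b, 'l, 'a) ann_triple = "('u, 'b, 'l) triple \<times> 'a"

type_synonym ('u, 'b, 'l, 'a) ann_graph = "('u, 'b, 'l, 'a) ann_triple set"

definition rho_df :: "('u, 'b, 'l) rdf_term set" where
  "rho_df = {URI Sp, URI Sc, URI Typ, URI Dom, URI Rng}"

definition annotated_triple :: "('u, 'b, 'l, 'a::annotation_domain) ann_triple \<Rightarrow> bool" where
  "annotated_triple t \<longleftrightarrow> snd t \<noteq> 0"

definition annotated_graph :: "('u, 'b, 'l, 'a::annotation_domain) ann_graph \<Rightarrow> bool" where
  "annotated_graph G \<longleftrightarrow> finite G \<and> (\<forall>t\<in>G. annotated_triple t)"

definition universe :: "('u, 'b, 'l, 'a) ann_graph \<Rightarrow> ('u, 'b, 'l) rdf_term set" where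
  "universe G = (\<Union>((s, p, v), a)\<in>G. {s, URI p, v})"

definition ground :: "('u, 'b, 'l, 'a) ann_graph \<Rightarrow> bool" where
  "ground G \<longleftrightarrow> universe G \<inter> range Blank = {}"

definition rdf_map :: "(('u, 'b, 'l) rdf_term \<Rightarrow> ('u, 'b, 'l) rdf_term) \<Rightarrow> bool" where
  "rdf_map \<mu> \<longleftrightarrow> (\<forall>t. t \<notin> range Blank \<longrightarrow> \<mu> t = t)"

text \<open>A map fixes URI references, so predicates are left unchanged.\<close>

definition map_graph ::
  "(('u, 'b, 'l) rdf_term \<Rightarrow> ('u, 'b, 'l) rdf_term) \<Rightarrow>
    ('u, 'b, 'l, 'a) ann_graph \<Rightarrow> ('u, 'b, 'l, 'a) ann_graph" where
  "map_graph \<mu> G = (\<lambda>((s, p, v), a). ((\<mu> s, p, \<mu> v), a)) ` G"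

definition grounding :: "('u, 'b, 'l, 'a) ann_graph \<Rightarrow> ('u, 'b, 'l, 'a) ann_graph \<Rightarrow> bool" where
  "grounding G' G \<longleftrightarrow> (\<exists>\<mu>. rdf_map \<mu> \<and> G' = map_graph \<mu> G) \<and> ground G'"


section \<open>Interpretations\<close>

text \<open>
  Partial functions into \<open>L\<close> are maps with values in \<open>'a option\<close>. An inequality between partial
  expressions is required only where its left-hand side is defined and different from \<open>\<bottom>\<close>,
  and then its right-hand side must be defined.
\<close>

definition opt_otimes :: "'a::annotation_domain option \<Rightarrow> 'a option \<Rightarrow> 'a option"
    (infixl "\<otimes>" 70) where
  "X \<otimes> Y = (case (X, Y) of (Some a, Some b) \<Rightarrow> Some (a * b) | _ \<Rightarrow> None)"

definition opt_le :: "'a::annotation_domain option \<Rightarrow> 'a option \<Rightarrow> bool" (infix "\<lesssim>" 50) where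
  "X \<lesssim> Y \<longleftrightarrow> (\<forall>a. X = Some a \<and> a \<noteq> 0 \<longrightarrow> (\<exists>b. Y = Some b \<and> a \<preceq> b))"

text \<open>
  Domain elements are RDF terms (so that plain literals can denote themselves) or elements of
  an arbitrary further type \<open>'d\<close>.
\<close>

type_synonym ('u, 'b, 'l, 'd) resource = "('u, 'b, 'l) rdf_term + 'd"

record ('u, 'b, 'l, 'd, 'a) interp =
  voc :: "('u, 'b, 'l) rdf_term set"
  Delta_R :: "('u, 'b, 'l, 'd) resource set"
  Delta_P :: "('u, 'b, 'l, 'd) resource set"
  Delta_C :: "('u, 'b, 'l, 'd) resource set"
  Delta_L :: "('u, 'b, 'l, 'd) resource set"
  P_ext :: "('u, 'b, 'l, 'd) resource \<Rightarrow>
    ('u, 'b, 'l, 'd) resource \<times> ('u, 'b, 'l, 'd) resource \<Rightarrow> 'a option"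
  C_ext :: "('u, 'b, 'l, 'd) resource \<Rightarrow> ('u, 'b, 'l, 'd) resource \<Rightarrow> 'a option"
  den :: "('u, 'b, 'l) rdf_term \<Rightarrow> ('u, 'b, 'l, 'd) resource"

text \<open>
  The parameter \<open>plain\<close> is the set of plain literals. The maps \<open>P_ext I\<close> and \<open>C_ext I\<close> have the
  domains \<open>Delta_P I\<close> and \<open>Delta_C I\<close>: elsewhere they are conventionally the empty map, so that
  every expression below is defined exactly where it is in the text. The domains of
  \<open>P_ext I (den I e)\<close>, for \<open>e\<close> in rho-df, are prescribed by Typing II.
\<close>

definition interpretation_wf :: "'l set \<Rightarrow> ('u, 'b, 'l, 'd, 'a) interp \<Rightarrow> bool" where
  "interpretation_wf plain I \<longleftrightarrow>
    finite (Delta_R I) \<and> Delta_R I \<noteq> {} \<and> finite (Delta_P I) \<and>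
    Delta_C I \<subseteq> Delta_R I \<and> Delta_L I \<subseteq> Delta_R I \<and>
    (\<forall>l\<in>plain. Literal l \<in> voc I \<longrightarrow> Inl (Literal l) \<in> Delta_L I) \<and>
    (\<forall>p\<in>Delta_P I. dom (P_ext I p) \<subseteq> Delta_R I \<times> Delta_R I) \<and>
    (\<forall>p\<in>Delta_P I - den I ` (rho_df \<inter> voc I). dom (P_ext I p) = Delta_R I \<times> Delta_R I) \<and>
    (\<forall>p. p \<notin> Delta_P I \<longrightarrow> P_ext I p = Map.empty) \<and>
    (\<forall>c\<in>Delta_C I. dom (C_ext I c) = Delta_R I) \<and>
    (\<forall>c. c \<notin> Delta_C I \<longrightarrow> C_ext I c = Map.empty) \<and>
    (\<forall>t\<in>voc I. t \<notin> range Blank \<longrightarrow> den I t \<in> Delta_R I \<union> Delta_P I) \<and>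
    (\<forall>l\<in>plain. Literal l \<in> voc I \<longrightarrow> den I (Literal l) = Inl (Literal l)) \<and>
    (\<forall>l. Literal l \<in> voc I \<longrightarrow> den I (Literal l) \<in> Delta_R I)"


section \<open>Models\<close>

abbreviation P_uri ::
  "('u, 'b, 'l, 'd, 'a) interp \<Rightarrow> 'u uri \<Rightarrow>
    ('u, 'b, 'l, 'd) resource \<times> ('u, 'b, 'l, 'd) resource \<Rightarrow> 'a option" where
  "P_uri I e \<equiv> P_ext I (den I (URI e))"

definition sat_simple ::
  "('u, 'b, 'l, 'd, 'a::annotation_domain) interp \<Rightarrow> ('u, 'b, 'l, 'a) ann_graph \<Rightarrow> bool" where
  "sat_simple I G \<longleftrightarrow> (\<forall>s p v a. ((s, p, v), a) \<in> G \<longrightarrow>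
    den I (URI p) \<in> Delta_P I \<and> Some a \<lesssim> P_uri I p (den I s, den I v))"

definition sat_subproperty :: "('u, 'b, 'l, 'd, 'a::annotation_domain) interp \<Rightarrow> bool" where
  "sat_subproperty I \<longleftrightarrow>
    (\<forall>p q r. P_uri I Sp (p, q) \<otimes> P_uri I Sp (q, r) \<lesssim> P_uri I Sp (p, r)) \<and>
    (\<forall>p q x y. P_ext I p (x, y) \<otimes> P_uri I Sp (p, q) \<lesssim> P_ext I q (x, y))"

definition sat_subclass :: "('u, 'b, 'l, 'd, 'a::annotation_domain) interp \<Rightarrow> bool" where
  "sat_subclass I \<longleftrightarrow>
    (\<forall>c d e. P_uri I Sc (c, d) \<otimes> P_uri I Sc (d, e) \<lesssim> P_uri I Sc (c, e)) \<and>
    (\<forall>c d x. C_ext I c x \<otimes> P_uri I Sc (c, d) \<lesssim> C_ext I d x)"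

definition sat_typing1 :: "('u, 'b, 'l, 'd, 'a::annotation_domain) interp \<Rightarrow> bool" where
  "sat_typing1 I \<longleftrightarrow>
    (\<forall>c\<in>Delta_C I. \<forall>x\<in>Delta_R I. C_ext I c x = P_uri I Typ (x, c)) \<and>
    (\<forall>p c x y. P_uri I Dom (p, c) \<otimes> P_ext I p (x, y) \<lesssim> C_ext I c x) \<and>
    (\<forall>p c x y. P_uri I Rng (p, c) \<otimes> P_ext I p (x, y) \<lesssim> C_ext I c y)"

text \<open>
  \<open>Delta_P I\<close> need not be included in \<open>Delta_R I\<close>, while the arguments of a property extension
  are always taken from \<open>Delta_R I\<close>.
\<close>

definition sat_typing2 :: "('u, 'b, 'l, 'd, 'a) interp \<Rightarrow> bool" where
  "sat_typing2 I \<longleftrightarrow>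
    (\<forall>e\<in>rho_df. den I e \<in> Delta_P I) \<and>
    dom (P_uri I Sp) = (Delta_P I \<inter> Delta_R I) \<times> (Delta_P I \<inter> Delta_R I) \<and>
    dom (P_uri I Sc) = Delta_C I \<times> Delta_C I \<and>
    dom (P_uri I Dom) = (Delta_P I \<inter> Delta_R I) \<times> Delta_C I \<and>
    dom (P_uri I Rng) = (Delta_P I \<inter> Delta_R I) \<times> Delta_C I \<and>
    dom (P_uri I Typ) = Delta_R I \<times> Delta_C I"

definition model ::
  "'l set \<Rightarrow> ('u, 'b, 'l, 'd, 'a::annotation_domain) interp \<Rightarrow>
    ('u, 'b, 'l, 'a) ann_graph \<Rightarrow> bool" where
  "model plain I G \<longleftrightarrow>
    interpretation_wf plain I \<and> rho_df \<union> universe G \<subseteq> voc I \<and>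
    sat_simple I G \<and> sat_subproperty I \<and> sat_subclass I \<and> sat_typing1 I \<and> sat_typing2 I"


section \<open>Entailment\<close>

text \<open>
  The type argument records the type \<open>'d\<close> that the quantification over interpretations uses.
  Every choice of \<open>'d\<close> covers all interpretations up to renaming of domain elements: the
  domains are finite, and for infinite \<open>'u\<close> there are infinitely many resources besides the
  literals.
\<close>

definition ground_entails ::
  "'d itself \<Rightarrow> 'l set \<Rightarrow> ('u, 'b, 'l, 'a::annotation_domain) ann_graph \<Rightarrow>
    ('u, 'b, 'l, 'a) ann_graph \<Rightarrow> bool" where
  "ground_entails (_ :: 'd itself) plain G H \<longleftrightarrow>
    (\<forall>I :: ('u, 'b, 'l, 'd, 'a) interp.
      model plain I G \<and> universe H \<subseteq> voc I \<longrightarrow> model plain I H)"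

definition entails ::
  "'d itself \<Rightarrow> 'l set \<Rightarrow> ('u, 'b, 'l, 'a::annotation_domain) ann_graph \<Rightarrow>
    ('u, 'b, 'l, 'a) ann_graph \<Rightarrow> bool" where
  "entails d plain G H \<longleftrightarrow>
    (\<forall>G'. grounding G' G \<longrightarrow> (\<exists>H'. grounding H' H \<and> ground_entails d plain G' H'))"


section \<open>Proof system\<close>

text \<open>
  Terms that occur in predicate position have to be URI references for the expressions to be
  triples; this is why the variables in that position have type \<open>'u uri\<close>.
\<close>

inductive rule_step ::
  "('u, 'b, 'l, 'a::annotation_domain) ann_graph \<Rightarrow> ('u, 'b, 'l, 'a) ann_graph \<Rightarrow> bool" where
  rule_1a: "annotated_graph G' \<Longrightarrow> rdf_map \<mu> \<Longrightarrow> map_graph \<mu> G' \<subseteq> G \<Longrightarrow> rule_step G G'"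
| rule_1b: "G' \<subseteq> G \<Longrightarrow> rule_step G G'"
| rule_2a: "((A, Sp, B), l1) \<in> G \<Longrightarrow> ((B, Sp, C), l2) \<in> G \<Longrightarrow> l1 * l2 \<noteq> 0 \<Longrightarrow>
    rule_step G (insert ((A, Sp, C), l1 * l2) G)"
| rule_2b: "((URI D, Sp, URI E), l1) \<in> G \<Longrightarrow> ((X, D, Y), l2) \<in> G \<Longrightarrow> l1 * l2 \<noteq> 0 \<Longrightarrow>
    rule_step G (insert ((X, E, Y), l1 * l2) G)"
| rule_3a: "((A, Sc, B), l1) \<in> G \<Longrightarrow> ((B, Sc, C), l2) \<in> G \<Longrightarrow> l1 * l2 \<noteq> 0 \<Longrightarrow>
    rule_step G (insert ((A, Sc, C), l1 * l2) G)"
| rule_3b: "((A, Sc, B), l1) \<in> G \<Longrightarrow> ((X, Typ, A), l2) \<in> G \<Longrightarrow> l1 * l2 \<noteq> 0 \<Longrightarrow>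
    rule_step G (insert ((X, Typ, B), l1 * l2) G)"
| rule_4a: "((URI D, Dom, B), l1) \<in> G \<Longrightarrow> ((X, D, Y), l2) \<in> G \<Longrightarrow> l1 * l2 \<noteq> 0 \<Longrightarrow>
    rule_step G (insert ((X, Typ, B), l1 * l2) G)"
| rule_4b: "((URI D, Rng, B), l1) \<in> G \<Longrightarrow> ((X, D, Y), l2) \<in> G \<Longrightarrow> l1 * l2 \<noteq> 0 \<Longrightarrow>
    rule_step G (insert ((Y, Typ, B), l1 * l2) G)"
| rule_5a: "((A, Dom, B), l1) \<in> G \<Longrightarrow> ((URI D, Sp, A), l2) \<in> G \<Longrightarrow> ((X, D, Y), l3) \<in> G \<Longrightarrow>
    l1 * l2 * l3 \<noteq> 0 \<Longrightarrow> rule_step G (insert ((X, Typ, B), l1 * l2 * l3) G)"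
| rule_5b: "((A, Rng, B), l1) \<in> G \<Longrightarrow> ((URI D, Sp, A), l2) \<in> G \<Longrightarrow> ((X, D, Y), l3) \<in> G \<Longrightarrow>
    l1 * l2 * l3 \<noteq> 0 \<Longrightarrow> rule_step G (insert ((Y, Typ, B), l1 * l2 * l3) G)"
| rule_6: "((X, A, Y), l1) \<in> G \<Longrightarrow> ((X, A, Y), l2) \<in> G \<Longrightarrow> l1 + l2 \<noteq> 0 \<Longrightarrow>
    rule_step G (insert ((X, A, Y), l1 + l2) (G - {((X, A, Y), l1), ((X, A, Y), l2)}))"

definition derives ::
  "('u, 'b, 'l, 'a::annotation_domain) ann_graph \<Rightarrow> ('u, 'b, 'l, 'a) ann_graph \<Rightarrow> bool"
    (infix "\<turnstile>" 50) where
  "G \<turnstile> H \<longleftrightarrow> rule_step\<^sup>*\<^sup>* G H"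

end

theory Submission
  imports Defs
begin

text \<open>
  Soundness is a rule-by-rule check. Since no rule leaves the vocabulary of rho-df and the current
  graph, every model interprets the vocabulary of all intermediate graphs.

  For completeness, blank nodes of \<open>G\<close> are replaced by fresh URI references, which a canonical
  model of the result interprets as the blank nodes themselves. The model is built from
  generalized triples, whose predicate may be any term; there the rules are all binary and
  rule 5 is a composition of rules 2b and 4. The value of a generalized triple should be the
  sum of all its derivable annotations, of which there may be infinitely many. But \<open>\<otimes>\<close> is
  decreasing, so cutting out the part of a derivation between two occurrences of a triple on a
  branch only increases the annotation, and it suffices to sum over the finitely many
  derivations without such repetitions. This finite sum is reached by rule 6, and a generalized
  derivation of a proper triple turns into a proper one because a predicate \<open>q\<close> that is not a URI
  reference can only be reached through some \<open>(D, sp, q)\<close> with \<open>D\<close> a URI reference.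
\<close>

section \<open>The order of an annotation domain\<close>

lemma ann_le_refl [simp]: "a \<preceq> a"
  by (simp add: ann_le_def oplus_idem)

lemma ann_le_trans [trans]: "a \<preceq> b \<Longrightarrow> b \<preceq> c \<Longrightarrow> a \<preceq> c"
  unfolding ann_le_def by (metis add.assoc)

lemma zero_ann_le [simp]: "0 \<preceq> a"
  by (simp add: ann_le_def)

lemma ann_le_zero_iff [simp]: "a \<preceq> 0 \<longleftrightarrow> a = 0"
  by (simp add: ann_le_def)

lemma add_ann_le: "a \<preceq> c \<Longrightarrow> b \<preceq> c \<Longrightarrow> a + b \<preceq> c"
  by (simp add: ann_le_def add.assoc)

lemma ann_le_add1: "a \<preceq> a + b"
  by (simp add: ann_le_def oplus_idem flip: add.assoc)

lemma mult_ann_le_mono: "a \<preceq> a' \<Longrightarrow> b \<preceq> b' \<Longrightarrow> a * b \<preceq> a' * b'"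
proof -
  assume "a \<preceq> a'" "b \<preceq> b'"
  then have "a * b \<preceq> a' * b" "a' * b \<preceq> a' * b'"
    by (simp_all add: ann_le_def flip: distrib_left distrib_right)
  then show ?thesis by (rule ann_le_trans)
qed

text \<open>Absorption \<open>1 + b = 1\<close>, multiplied by \<open>a\<close>. Hence cutting a
  derivation down to one of its subderivations never lowers the annotation.\<close>

lemma mult_ann_le1: "a * b \<preceq> a"
proof -
  have "a * b + a * 1 = a * (1 + b)"
    by (simp add: distrib_left add.commute)
  then show ?thesis by (simp add: ann_le_def top_oplus)
qed

lemma mult_ann_le2: "a * b \<preceq> b"
  by (metis mult_ann_le1 mult.commute)

lemma ann_le_sum:
  assumes "finite V" "v \<in> V"
  shows "v \<preceq> \<Sum>V"
  using assms by (simp add: sum.remove ann_le_add1)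

lemma sum_mult_sum_ann_le:
  assumes "\<And>v w. v \<in> V \<Longrightarrow> w \<in> W \<Longrightarrow> v * w \<preceq> c"
  shows "\<Sum>V * \<Sum>W \<preceq> c"
proof -
  have sum_le: "sum f A \<preceq> c" if "\<And>x. x \<in> A \<Longrightarrow> f x \<preceq> c" for f :: "'b \<Rightarrow> 'a" and A
    using that by (induction A rule: infinite_finite_induct) (auto intro: add_ann_le)
  show ?thesis
    unfolding sum_product by (intro sum_le assms)
qed

text \<open>Idempotence makes a repeated summand harmless, so merging annotations need not ask
  whether the merged one is already present.\<close>

lemma sum_insert_idem:
  fixes V :: "'a::annotation_domain set"
  assumes "finite V"
  shows "\<Sum>(insert v V) = v + \<Sum>V"
proof (cases "v \<in> V")
  case True
  then show ?thesis
    using ann_le_sum[OF assms True] by (simp add: insert_absorb ann_le_def)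
qed (simp add: assms)


section \<open>Soundness\<close>

lemma rdf_map_URI: "rdf_map \<mu> \<Longrightarrow> \<mu> (URI u) = URI u"
  by (auto simp: rdf_map_def)

lemma universe_map_graph:
  assumes "rdf_map \<mu>"
  shows "universe (map_graph \<mu> G) = \<mu> ` universe G"
  using rdf_map_URI[OF assms]
  by (fastforce simp: universe_def map_graph_def image_iff split_beta)

lemma rdf_map_comp: "rdf_map \<mu> \<Longrightarrow> rdf_map \<nu> \<Longrightarrow> rdf_map (\<nu> \<circ> \<mu>)"
  by (simp add: rdf_map_def)

lemma map_graph_comp: "map_graph \<nu> (map_graph \<mu> G) = map_graph (\<nu> \<circ> \<mu>) G"
  by (simp add: map_graph_def image_image split_beta)

lemma map_graph_mono: "G \<subseteq> H \<Longrightarrow> map_graph \<mu> G \<subseteq> map_graph \<mu> H"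
  unfolding map_graph_def by (rule image_mono)

lemma universe_mono: "G \<subseteq> H \<Longrightarrow> universe G \<subseteq> universe H"
  by (auto simp: universe_def)

lemma model_mono:
  assumes "model plain I G" "H \<subseteq> G"
  shows "model plain I H"
  using assms universe_mono[of H G] unfolding model_def sat_simple_def by blast

section \<open>Inequalities between partial values\<close>

lemma opt_otimes_commute: "X \<otimes> Y = Y \<otimes> X"
  by (cases X; cases Y) (simp_all add: opt_otimes_def mult.commute)

text \<open>Covers a rule with two premises. A nonzero \<open>a * b\<close> has nonzero factors, so
  \<open>X\<close> and \<open>Y\<close> are defined; their product lies above \<open>a * b\<close>,
  hence is nonzero too, and the inequality for \<open>Z\<close> applies.\<close>

lemma opt_le_mult:
  assumes "Some a \<lesssim> X" "Some b \<lesssim> Y" "X \<otimes> Y \<lesssim> Z"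
  shows "Some (a * b) \<lesssim> Z"
proof (cases "a * b = 0")
  case False
  then have "a \<noteq> 0" "b \<noteq> 0" by auto
  then obtain a' b' where *: "X = Some a'" "a \<preceq> a'" "Y = Some b'" "b \<preceq> b'"
    using assms(1,2) by (auto simp: opt_le_def)
  then have le: "a * b \<preceq> a' * b'" by (simp add: mult_ann_le_mono)
  with False have "a' * b' \<noteq> 0" by auto
  with assms(3) * obtain c where "Z = Some c" "a' * b' \<preceq> c"
    by (auto simp: opt_le_def opt_otimes_def)
  with le show ?thesis by (auto simp: opt_le_def intro: ann_le_trans)
qed (simp add: opt_le_def)

lemma opt_le_add:
  assumes "Some a \<lesssim> X" "Some b \<lesssim> X"
  shows "Some (a + b) \<lesssim> X"
  using assms by (cases "a = 0"; cases "b = 0") (auto simp: opt_le_def intro: add_ann_le)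

text \<open>Typing I speaks only of \<open>Delta_C\<close> and \<open>Delta_R\<close>; outside them
  both sides are undefined, by Typing II and the domains of \<open>C_ext\<close>. Class extensions
  can thus be eliminated everywhere.\<close>

lemma C_ext_eq_type:
  assumes "model plain I G"
  shows "C_ext I c x = P_uri I Typ (x, c)"
proof (cases "c \<in> Delta_C I \<and> x \<in> Delta_R I")
  case True
  then show ?thesis using assms by (auto simp: model_def sat_typing1_def)
next
  case False
  from assms have "(x, c) \<notin> dom (P_uri I Typ)"
    using False by (auto simp: model_def sat_typing2_def)
  moreover from assms have "x \<notin> dom (C_ext I c)"
    using False by (cases "c \<in> Delta_C I") (simp_all add: model_def interpretation_wf_def)
  ultimately have "C_ext I c x = None" "P_uri I Typ (x, c) = None"
    by (simp_all add: domIff)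
  then show ?thesis by simp
qed

text \<open>\<open>e\<close> will be the denotation composed with a grounding map, so that the rules can be checked
  on graphs with blank nodes.\<close>

definition holds ::
  "('u, 'b, 'l, 'd, 'a::annotation_domain) interp \<Rightarrow>
    (('u, 'b, 'l) rdf_term \<Rightarrow> ('u, 'b, 'l, 'd) resource) \<Rightarrow> ('u, 'b, 'l, 'a) ann_triple \<Rightarrow> bool" where
  "holds I e = (\<lambda>((s, p, v), a). den I (URI p) \<in> Delta_P I \<and> Some a \<lesssim> P_uri I p (e s, e v))"

text \<open>Membership in \<open>Delta_P\<close> comes for free: outside it extensions are empty,
  whereas a nonzero lower bound requires a defined value.\<close>

lemma holdsI:
  assumes "model plain I G" "a \<noteq> 0" "Some a \<lesssim> P_uri I p (e s, e v)"
  shows "holds I e ((s, p, v), a)"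
proof -
  have "P_uri I p \<noteq> Map.empty"
    using assms(2,3) by (auto simp: opt_le_def)
  then have "den I (URI p) \<in> Delta_P I"
    using assms(1) by (auto simp: model_def interpretation_wf_def)
  with assms(3) show ?thesis by (simp add: holds_def)
qed

lemma sat_simple_map_graph:
  "sat_simple I (map_graph \<mu> G) \<longleftrightarrow> (\<forall>t\<in>G. holds I (den I \<circ> \<mu>) t)"
proof -
  have "sat_simple I H \<longleftrightarrow> (\<forall>t\<in>H. holds I (den I) t)" for H
    by (auto simp: sat_simple_def holds_def)
  then show ?thesis
    by (simp add: map_graph_def holds_def split_beta)
qed

text \<open>Rule 1a may introduce foreign blank nodes, so there only the map is recorded. In the
  rules that add a triple, subject and object come from the premises, and the predicate is a term of
  the premises or \<open>Typ\<close>.\<close>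

lemma rule_step_universe:
  assumes "rule_step G H"
  shows "(\<exists>\<mu>. rdf_map \<mu> \<and> map_graph \<mu> H \<subseteq> G) \<or> universe H \<subseteq> rho_df \<union> universe G"
proof -
  have ins: "universe (insert ((s, p, v), a) K) = {s, URI p, v} \<union> universe K" for s p v a K
    by (simp add: universe_def)
  have mem: "s \<in> universe K \<and> URI p \<in> universe K \<and> v \<in> universe K"
    if "((s, p, v), a) \<in> K" for s p v a K
    using that by (force simp: universe_def)
  have rho: "URI Typ \<in> rho_df" by (simp add: rho_df_def)
  show ?thesis using assms
  proof cases
    case (rule_1a \<mu>)
    then show ?thesis by blast
  next
    case rule_1b
    then show ?thesis using universe_mono by blast
  next
    case (rule_6 X A Y l1 l2)
    then show ?thesis
      using mem[OF rule_6(2)] universe_mono[of "G - {((X, A, Y), l1), ((X, A, Y), l2)}" G]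
      by (auto simp: ins)
  qed (use rho in \<open>auto simp: ins dest!: mem\<close>)
qed

text \<open>Rule 1a is not covered: it acts on the grounding instead.\<close>

lemma rule_step_holds:
  assumes "rule_step G H"
    and not_1a: "\<nexists>\<mu>. rdf_map \<mu> \<and> map_graph \<mu> H \<subseteq> G"
    and M: "model plain I K"
    and e: "\<And>u. e (URI u) = den I (URI u)"
    and G: "\<And>t. t \<in> G \<Longrightarrow> holds I e t"
    and "t \<in> H"
  shows "holds I e t"
proof -
  \<comment> \<open>The model conditions with their factors in the order of the rule premises, and
    with class extensions replaced by \<open>Typ\<close>.\<close>
  have sp: "P_uri I Sp (p, q) \<otimes> P_uri I Sp (q, r) \<lesssim> P_uri I Sp (p, r)"
    "P_uri I Sp (p, q) \<otimes> P_ext I p (x, y) \<lesssim> P_ext I q (x, y)"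
    and sc: "P_uri I Sc (p, q) \<otimes> P_uri I Sc (q, r) \<lesssim> P_uri I Sc (p, r)"
    "P_uri I Sc (p, q) \<otimes> P_uri I Typ (x, p) \<lesssim> P_uri I Typ (x, q)"
    and ty: "P_uri I Dom (p, q) \<otimes> P_ext I p (x, y) \<lesssim> P_uri I Typ (x, q)"
    "P_uri I Rng (p, q) \<otimes> P_ext I p (x, y) \<lesssim> P_uri I Typ (y, q)" for p q r x y
    using M opt_otimes_commute[of "P_uri I Sp (p, q)" "P_ext I p (x, y)"]
      opt_otimes_commute[of "P_uri I Sc (p, q)" "C_ext I p x"]
    by (simp_all add: model_def sat_subproperty_def sat_subclass_def sat_typing1_def
        flip: C_ext_eq_type[OF M])
  have inG: "Some l \<lesssim> P_uri I p (e s, e v)" if "((s, p, v), l) \<in> G" for s p v l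
    using G[OF that] by (simp add: holds_def)
  show ?thesis using assms(1)
  proof cases
    case (rule_1a \<mu>)
    then show ?thesis using not_1a by blast
  next
    case rule_1b
    then show ?thesis using G \<open>t \<in> H\<close> by blast
  next
    case (rule_2a A B l1 C l2)
    have "holds I e ((A, Sp, C), l1 * l2)"
      using opt_le_mult[OF inG[OF rule_2a(2)] inG[OF rule_2a(3)], unfolded e, OF sp(1)] rule_2a(4)
      by (intro holdsI[OF M]) (simp_all add: e)
    with rule_2a show ?thesis using G \<open>t \<in> H\<close> by blast
  next
    case (rule_2b D E l1 X Y l2)
    have "holds I e ((X, E, Y), l1 * l2)"
      using opt_le_mult[OF inG[OF rule_2b(2)] inG[OF rule_2b(3)], unfolded e, OF sp(2)] rule_2b(4)
      by (intro holdsI[OF M]) (simp_all add: e)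
    with rule_2b show ?thesis using G \<open>t \<in> H\<close> by blast
  next
    case (rule_3a A B l1 C l2)
    have "holds I e ((A, Sc, C), l1 * l2)"
      using opt_le_mult[OF inG[OF rule_3a(2)] inG[OF rule_3a(3)], unfolded e, OF sc(1)] rule_3a(4)
      by (intro holdsI[OF M]) (simp_all add: e)
    with rule_3a show ?thesis using G \<open>t \<in> H\<close> by blast
  next
    case (rule_3b A B l1 X l2)
    have "holds I e ((X, Typ, B), l1 * l2)"
      using opt_le_mult[OF inG[OF rule_3b(2)] inG[OF rule_3b(3)], unfolded e, OF sc(2)] rule_3b(4)
      by (intro holdsI[OF M]) (simp_all add: e)
    with rule_3b show ?thesis using G \<open>t \<in> H\<close> by blast
  next
    case (rule_4a D B l1 X Y l2)
    have "holds I e ((X, Typ, B), l1 * l2)"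
      using opt_le_mult[OF inG[OF rule_4a(2)] inG[OF rule_4a(3)], unfolded e, OF ty(1)] rule_4a(4)
      by (intro holdsI[OF M]) (simp_all add: e)
    with rule_4a show ?thesis using G \<open>t \<in> H\<close> by blast
  next
    case (rule_4b D B l1 X Y l2)
    have "holds I e ((Y, Typ, B), l1 * l2)"
      using opt_le_mult[OF inG[OF rule_4b(2)] inG[OF rule_4b(3)], unfolded e, OF ty(2)] rule_4b(4)
      by (intro holdsI[OF M]) (simp_all add: e)
    with rule_4b show ?thesis using G \<open>t \<in> H\<close> by blast
  next
    case (rule_5a A B l1 D l2 X Y l3)
    \<comment> \<open>\<open>A\<close> may be a blank node or a literal, so \<open>(X, A, Y)\<close>
      need not be a triple; semantically the step through the property \<open>e A\<close> is
      possible all the same.\<close>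
    have "Some (l2 * l3) \<lesssim> P_ext I (e A) (e X, e Y)"
      using opt_le_mult[OF inG[OF rule_5a(3)] inG[OF rule_5a(4)], unfolded e, OF sp(2)] .
    from opt_le_mult[OF inG[OF rule_5a(2)] this, unfolded e, OF ty(1)] rule_5a(5)
    have "holds I e ((X, Typ, B), l1 * l2 * l3)"
      by (intro holdsI[OF M]) (simp_all add: e mult.assoc)
    with rule_5a show ?thesis using G \<open>t \<in> H\<close> by blast
  next
    case (rule_5b A B l1 D l2 X Y l3)
    have "Some (l2 * l3) \<lesssim> P_ext I (e A) (e X, e Y)"
      using opt_le_mult[OF inG[OF rule_5b(3)] inG[OF rule_5b(4)], unfolded e, OF sp(2)] .
    from opt_le_mult[OF inG[OF rule_5b(2)] this, unfolded e, OF ty(2)] rule_5b(5)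
    have "holds I e ((Y, Typ, B), l1 * l2 * l3)"
      by (intro holdsI[OF M]) (simp_all add: e mult.assoc)
    with rule_5b show ?thesis using G \<open>t \<in> H\<close> by blast
  next
    case (rule_6 X A Y l1 l2)
    have "holds I e ((X, A, Y), l1 + l2)"
      using opt_le_add[OF inG[OF rule_6(2)] inG[OF rule_6(3)]] rule_6(4)
      by (intro holdsI[OF M])
    with rule_6 show ?thesis using G \<open>t \<in> H\<close> by blast
  qed
qed

lemma rule_step_sound:
  fixes G H :: "('u, 'b, 'l, 'a::annotation_domain) ann_graph"
  assumes "rule_step G H" "grounding G' G"
  shows "\<exists>H'. grounding H' H \<and> universe H' \<subseteq> rho_df \<union> universe G' \<and>
    (\<forall>I :: ('u, 'b, 'l, 'd, 'a) interp. model plain I G' \<longrightarrow> sat_simple I H')"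
proof -
  from assms(2) obtain \<mu> where \<mu>: "rdf_map \<mu>" and G': "G' = map_graph \<mu> G" and gr: "ground G'"
    unfolding grounding_def by blast
  show ?thesis
  proof (cases "\<exists>\<nu>. rdf_map \<nu> \<and> map_graph \<nu> H \<subseteq> G")
    case True
    then obtain \<nu> where \<nu>: "rdf_map \<nu>" "map_graph \<nu> H \<subseteq> G" by blast
    \<comment> \<open>Rule 1a: first map \<open>H\<close> into \<open>G\<close>, then ground by
      \<open>\<mu>\<close>; the result lies inside \<open>G'\<close>.\<close>
    define H' where "H' = map_graph (\<mu> \<circ> \<nu>) H"
    have sub: "H' \<subseteq> G'"
      using map_graph_mono[OF \<nu>(2), of \<mu>] by (simp add: G' H'_def map_graph_comp)
    have "ground H'"
      using gr universe_mono[OF sub] by (auto simp: ground_def)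
    then have "grounding H' H"
      using rdf_map_comp[OF \<nu>(1) \<mu>] by (auto simp: grounding_def H'_def)
    moreover have "sat_simple I H'" if "model plain I G'" for I :: "('u, 'b, 'l, 'd, 'a) interp"
      using model_mono[OF that sub] by (simp add: model_def)
    ultimately show ?thesis
      using universe_mono[OF sub] by blast
  next
    case False
    define H' where "H' = map_graph \<mu> H"
    have rho: "\<mu> ` rho_df = rho_df" "rho_df \<inter> range Blank = {}"
      using rdf_map_URI[OF \<mu>] by (auto simp: rho_df_def)
    have "universe H \<subseteq> rho_df \<union> universe G"
      using rule_step_universe[OF assms(1)] False by blast
    from image_mono[OF this, of \<mu>] have univ: "universe H' \<subseteq> rho_df \<union> universe G'"
      by (simp add: H'_def G' universe_map_graph[OF \<mu>] image_Un rho(1))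
    then have "ground H'"
      using gr rho(2) unfolding ground_def by blast
    then have "grounding H' H"
      using \<mu> by (auto simp: grounding_def H'_def)
    moreover have "sat_simple I H'" if M: "model plain I G'" for I :: "('u, 'b, 'l, 'd, 'a) interp"
    proof -
      have "holds I (den I \<circ> \<mu>) t" if "t \<in> G" for t
        using M that unfolding model_def G' sat_simple_map_graph by blast
      moreover have "(den I \<circ> \<mu>) (URI u) = den I (URI u)" for u
        using rdf_map_URI[OF \<mu>] by simp
      ultimately show ?thesis
        unfolding H'_def sat_simple_map_graph
        using rule_step_holds[OF assms(1) False M] by blast
    qed
    ultimately show ?thesis
      using univ by blast
  qed
qed

theorem derives_sound:
  fixes G H :: "('u, 'b, 'l, 'a::annotation_domain) ann_graph"
  assumes "G \<turnstile> H"
  shows "entails TYPE('d) plain G H"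
proof -
  \<comment> \<open>The grounding is fixed before the interpretation, as \<open>entails\<close>
    demands. The vocabulary bound travels along because a model must interpret the graph it
    satisfies.\<close>
  have "\<exists>H'. grounding H' H \<and> universe H' \<subseteq> rho_df \<union> universe G' \<and>
      (\<forall>I :: ('u, 'b, 'l, 'd, 'a) interp. model plain I G' \<longrightarrow> model plain I H')"
    if G': "grounding G' G" for G'
    using assms unfolding derives_def
  proof (induction rule: rtranclp_induct)
    case base
    then show ?case using G' by blast
  next
    case (step H K)
    then obtain H' where H': "grounding H' H" "universe H' \<subseteq> rho_df \<union> universe G'"
      "\<And>I :: ('u, 'b, 'l, 'd, 'a) interp. model plain I G' \<Longrightarrow> model plain I H'"
      by blast
    from rule_step_sound[OF step(2) H'(1), where 'd = 'd and plain = plain]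
    obtain K' where K': "grounding K' K" "universe K' \<subseteq> rho_df \<union> universe H'"
      "\<And>I :: ('u, 'b, 'l, 'd, 'a) interp. model plain I H' \<Longrightarrow> sat_simple I K'"
      by blast
    have univ: "universe K' \<subseteq> rho_df \<union> universe G'"
      using H'(2) K'(2) by blast
    \<comment> \<open>Only the vocabulary condition and \<open>sat_simple\<close> depend on the
      graph; the rest is taken over from \<open>G'\<close>.\<close>
    have "model plain I K'" if M: "model plain I G'" for I :: "('u, 'b, 'l, 'd, 'a) interp"
      using M univ K'(3)[OF H'(3)[OF M]] unfolding model_def by blast
    with K'(1) univ show ?case by blast
  qed
  then show ?thesis
    unfolding entails_def ground_entails_def by meson
qed


section \<open>Derivations without repetitions\<close>

text \<open>\<open>F\<close> collects the conclusions on the path to the root, which may not occur again.\<close>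

inductive simple_deriv ::
  "'t set \<Rightarrow> ('t \<Rightarrow> 't \<Rightarrow> 't \<Rightarrow> bool) \<Rightarrow> ('t \<times> 'a::annotation_domain) set \<Rightarrow>
    't set \<Rightarrow> 't \<Rightarrow> 'a \<Rightarrow> bool" for U R B where
  base: "(t, v) \<in> B \<Longrightarrow> t \<in> U \<Longrightarrow> t \<notin> F \<Longrightarrow> simple_deriv U R B F t v"
| step: "R t1 t2 t \<Longrightarrow> t \<in> U \<Longrightarrow> t \<notin> F \<Longrightarrow> simple_deriv U R B (insert t F) t1 v1 \<Longrightarrow>
    simple_deriv U R B (insert t F) t2 v2 \<Longrightarrow> simple_deriv U R B F t (v1 * v2)"

lemma simple_deriv_antimono:
  "simple_deriv U R B F t v \<Longrightarrow> E \<subseteq> F \<Longrightarrow> simple_deriv U R B E t v"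
proof (induction arbitrary: E rule: simple_deriv.induct)
  case (base t v F)
  then show ?case by (auto intro: simple_deriv.base)
next
  case (step t1 t2 t F v1 v2)
  from step.prems have "insert t E \<subseteq> insert t F" by blast
  then show ?case
    using step.hyps step.prems step.IH by (intro simple_deriv.step) auto
qed

text \<open>Premises forbid one more triple of \<open>U\<close>, hence the induction on the size of
  \<open>U - F\<close>: a value is a base annotation or a product of two values obtained with
  \<open>t\<close> forbidden.\<close>

lemma finite_simple_deriv:
  assumes "finite U" "finite B"
  shows "finite {v. simple_deriv U R B F t v}"
proof (induction "card (U - F)" arbitrary: F t rule: less_induct)
  case less
  show ?case
  proof (cases "t \<in> U - F")
    case True
    let ?V = "\<lambda>s. {v. simple_deriv U R B (insert t F) s v}"
    have "U - insert t F \<subset> U - F" using True by blast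
    then have "finite (?V s)" for s
      using less assms(1) by (simp add: psubset_card_mono)
    then have "finite (snd ` B \<union> (\<Union>s\<in>U. \<Union>s'\<in>U. \<Union>v\<in>?V s. (*) v ` ?V s'))"
      using assms by simp
    moreover have "{v. simple_deriv U R B F t v} \<subseteq>
        snd ` B \<union> (\<Union>s\<in>U. \<Union>s'\<in>U. \<Union>v\<in>?V s. (*) v ` ?V s')"
    proof
      fix v assume "v \<in> {v. simple_deriv U R B F t v}"
      then have "simple_deriv U R B F t v" by simp
      then show "v \<in> snd ` B \<union> (\<Union>s\<in>U. \<Union>s'\<in>U. \<Union>v\<in>?V s. (*) v ` ?V s')"
      proof cases
        case base
        then show ?thesis by force
      next
        case (step t1 t2 v1 v2)
        moreover from this have "t1 \<in> U" "t2 \<in> U"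
          by (auto elim: simple_deriv.cases)
        ultimately show ?thesis by blast
      qed
    qed
    ultimately show ?thesis by (rule rev_finite_subset)
  next
    case False
    then have "{v. simple_deriv U R B F t v} = {}"
      by (auto elim: simple_deriv.cases)
    then show ?thesis by (simp only: finite.emptyI)
  qed
qed

text \<open>The cutting argument: either \<open>s\<close> can be kept out of the derivation, or
  \<open>s\<close> is concluded somewhere in it, and that subderivation alone has a value above
  \<open>v\<close> because \<otimes> is decreasing.\<close>

lemma simple_deriv_avoid:
  assumes "simple_deriv U R B F t v"
  shows "(\<exists>w. v \<preceq> w \<and> simple_deriv U R B (insert s F) t w) \<or>
    (\<exists>w. v \<preceq> w \<and> simple_deriv U R B F s w)"
  using assms
proof (induction rule: simple_deriv.induct)
  case (base t v F)
  show ?case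
  proof (cases "t = s")
    case True
    with base have "simple_deriv U R B F s v" by (simp add: simple_deriv.base)
    then show ?thesis using ann_le_refl by blast
  next
    case False
    with base have "simple_deriv U R B (insert s F) t v" by (auto intro: simple_deriv.base)
    then show ?thesis by auto
  qed
next
  case (step t1 t2 t F v1 v2)
  show ?case
  proof (cases "t = s")
    case True
    with step.hyps have "simple_deriv U R B F s (v1 * v2)"
      using simple_deriv.step by metis
    then show ?thesis by auto
  next
    case False
    consider (left) w where "v1 \<preceq> w" "simple_deriv U R B (insert t F) s w"
      | (right) w where "v2 \<preceq> w" "simple_deriv U R B (insert t F) s w"
      | (avoid) w1 w2 where "v1 \<preceq> w1" "simple_deriv U R B (insert s (insert t F)) t1 w1"
        "v2 \<preceq> w2" "simple_deriv U R B (insert s (insert t F)) t2 w2"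
      using step.IH by blast
    then show ?thesis
    proof cases
      case left
      then show ?thesis
        using mult_ann_le1 ann_le_trans simple_deriv_antimono[OF left(2), of F] by blast
    next
      case right
      then show ?thesis
        using mult_ann_le2 ann_le_trans simple_deriv_antimono[OF right(2), of F] by blast
    next
      case avoid
      have "simple_deriv U R B (insert s F) t (w1 * w2)"
        using step.hyps False avoid by (intro simple_deriv.step) (auto simp: insert_commute)
      then show ?thesis using mult_ann_le_mono avoid by blast
    qed
  qed
qed

text \<open>Apply \<open>simple_deriv_avoid\<close> with \<open>s = t\<close> to both premises. If
  both can avoid \<open>t\<close>, the rule is applicable; otherwise a derivation of
  \<open>t\<close> inside one premise already dominates the product.\<close>

lemma simple_deriv_closed:
  assumes "R t1 t2 t" "t \<in> U" "simple_deriv U R B {} t1 v1" "simple_deriv U R B {} t2 v2"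
  shows "\<exists>w. v1 * v2 \<preceq> w \<and> simple_deriv U R B {} t w"
proof -
  consider (left) w where "v1 \<preceq> w" "simple_deriv U R B {} t w"
    | (right) w where "v2 \<preceq> w" "simple_deriv U R B {} t w"
    | (avoid) w1 w2 where "v1 \<preceq> w1" "simple_deriv U R B {t} t1 w1"
      "v2 \<preceq> w2" "simple_deriv U R B {t} t2 w2"
    using simple_deriv_avoid[OF assms(3), of t] simple_deriv_avoid[OF assms(4), of t] by blast
  then show ?thesis
  proof cases
    case left
    then show ?thesis using mult_ann_le1 ann_le_trans by blast
  next
    case right
    then show ?thesis using mult_ann_le2 ann_le_trans by blast
  next
    case avoid
    then have "simple_deriv U R B {} t (w1 * w2)"
      using assms(1,2) by (intro simple_deriv.step) auto
    then show ?thesis using mult_ann_le_mono avoid by blast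
  qed
qed

text \<open>The value of \<open>t\<close> in the canonical model. For finite \<open>U\<close> and
  \<open>B\<close> the index set is finite, so the sum does not fall back on its default 0; by
  idempotence, summing distinct values equals summing over derivations.\<close>

definition deriv_sum ::
  "'t set \<Rightarrow> ('t \<Rightarrow> 't \<Rightarrow> 't \<Rightarrow> bool) \<Rightarrow> ('t \<times> 'a::annotation_domain) set \<Rightarrow> 't \<Rightarrow> 'a" where
  "deriv_sum U R B t = \<Sum>{v. simple_deriv U R B {} t v}"

lemma deriv_sum_base:
  assumes "finite U" "finite B" "(t, v) \<in> B" "t \<in> U"
  shows "v \<preceq> deriv_sum U R B t"
  unfolding deriv_sum_def
proof (rule ann_le_sum)
  show "v \<in> {v. simple_deriv U R B {} t v}"
    using simple_deriv.base[OF assms(3,4)] by simp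
qed (rule finite_simple_deriv[OF assms(1,2)])

lemma deriv_sum_step:
  assumes "finite U" "finite B" "R t1 t2 t" "t \<in> U"
  shows "deriv_sum U R B t1 * deriv_sum U R B t2 \<preceq> deriv_sum U R B t"
  unfolding deriv_sum_def
proof (rule sum_mult_sum_ann_le)
  fix v w
  assume "v \<in> {v. simple_deriv U R B {} t1 v}" "w \<in> {v. simple_deriv U R B {} t2 v}"
  then obtain u where "v * w \<preceq> u" "simple_deriv U R B {} t u"
    using simple_deriv_closed assms(3,4) by (metis mem_Collect_eq)
  then show "v * w \<preceq> \<Sum>{v. simple_deriv U R B {} t v}"
    using ann_le_trans ann_le_sum finite_simple_deriv[OF assms(1,2)] by (metis mem_Collect_eq)
qed


section \<open>Generalized triples\<close>

type_synonym ('u, 'b, 'l) gen_triple =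
  "('u, 'b, 'l) rdf_term \<times> ('u, 'b, 'l) rdf_term \<times> ('u, 'b, 'l) rdf_term"

text \<open>In the canonical model every element is also a property, so the model conditions must
  hold for predicates that no triple can have. Each rule mirrors one inequality for subproperties,
  subclasses or typing.\<close>

inductive gen_rule ::
  "('u, 'b, 'l) gen_triple \<Rightarrow> ('u, 'b, 'l) gen_triple \<Rightarrow> ('u, 'b, 'l) gen_triple \<Rightarrow> bool" where
  sp_trans: "gen_rule (A, URI Sp, B) (B, URI Sp, C) (A, URI Sp, C)"
| sp: "gen_rule (D, URI Sp, E) (X, D, Y) (X, E, Y)"
| sc_trans: "gen_rule (A, URI Sc, B) (B, URI Sc, C) (A, URI Sc, C)"
| sc: "gen_rule (A, URI Sc, B) (X, URI Typ, A) (X, URI Typ, B)"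
| dom: "gen_rule (D, URI Dom, B) (X, D, Y) (X, URI Typ, B)"
| range: "gen_rule (D, URI Rng, B) (X, D, Y) (Y, URI Typ, B)"

definition gen_graph ::
  "('u, 'b, 'l, 'a) ann_graph \<Rightarrow> (('u, 'b, 'l) gen_triple \<times> 'a) set" where
  "gen_graph G = (\<lambda>((s, p, v), a). ((s, URI p, v), a)) ` G"

lemma gen_graph_iff: "((s, q, v), a) \<in> gen_graph G \<longleftrightarrow> (\<exists>p. q = URI p \<and> ((s, p, v), a) \<in> G)"
  by (auto simp: gen_graph_def intro: rev_image_eqI)

text \<open>Reachability in the proof system while keeping all triples; the quantifier over \<open>H\<close>
  makes it composable.\<close>

definition reach ::
  "('u, 'b, 'l, 'a::annotation_domain) ann_graph \<Rightarrow> ('u, 'b, 'l, 'a) ann_triple \<Rightarrow> bool" where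
  "reach G t \<longleftrightarrow> (\<forall>H. G \<subseteq> H \<longrightarrow> (\<exists>H'. H \<turnstile> H' \<and> H \<subseteq> H' \<and> t \<in> H'))"

section \<open>Enlarging a graph by derivable triples\<close>

lemma derives_refl: "G \<turnstile> G"
  by (simp add: derives_def)

lemma derives_trans: "G \<turnstile> H \<Longrightarrow> H \<turnstile> K \<Longrightarrow> G \<turnstile> K"
  unfolding derives_def by (rule rtranclp_trans)

lemma derives_step: "rule_step G H \<Longrightarrow> G \<turnstile> H"
  unfolding derives_def by (rule r_into_rtranclp)

lemma reach_mem: "t \<in> G \<Longrightarrow> reach G t"
  unfolding reach_def using derives_refl by blast

text \<open>Triples are added one after the other, since \<open>reach\<close> works over every
  supergraph and keeps what was there.\<close>

lemma reach_finite:
  assumes "finite T" "\<And>t. t \<in> T \<Longrightarrow> reach G t" "G \<subseteq> H"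
  shows "\<exists>H'. H \<turnstile> H' \<and> H \<subseteq> H' \<and> T \<subseteq> H'"
  using assms(1,2)
proof (induction rule: finite_induct)
  case empty
  then show ?case using derives_refl by blast
next
  case (insert t T)
  then obtain H' where H': "H \<turnstile> H'" "H \<subseteq> H'" "T \<subseteq> H'" by blast
  with assms(3) insert.prems[of t] obtain H'' where H'': "H' \<turnstile> H''" "H' \<subseteq> H''" "t \<in> H''"
    unfolding reach_def by (meson insertI1 order_trans)
  have "H \<turnstile> H''" using H'(1) H''(1) by (rule derives_trans)
  moreover have "H \<subseteq> H''" "insert t T \<subseteq> H''" using H' H'' by auto
  ultimately show ?case by blast
qed

lemma reach_step:
  assumes "finite T" "\<And>t. t \<in> T \<Longrightarrow> reach G t"
    and "\<And>H. T \<subseteq> H \<Longrightarrow> rule_step H (insert t H)"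
  shows "reach G t"
  unfolding reach_def
proof (intro allI impI)
  fix H assume "G \<subseteq> H"
  with reach_finite[OF assms(1,2)] obtain H' where H': "H \<turnstile> H'" "H \<subseteq> H'" "T \<subseteq> H'"
    by meson
  have "H \<turnstile> insert t H'"
    using H'(1) derives_step[OF assms(3)[OF H'(3)]] by (rule derives_trans)
  moreover have "H \<subseteq> insert t H'" "t \<in> insert t H'" using H'(2) by auto
  ultimately show "\<exists>H'. H \<turnstile> H' \<and> H \<subseteq> H' \<and> t \<in> H'" by blast
qed

lemma reach_step2:
  assumes "reach G t1" "reach G t2"
    and "\<And>H. t1 \<in> H \<Longrightarrow> t2 \<in> H \<Longrightarrow> rule_step H (insert t H)"
  shows "reach G t"
proof (rule reach_step)
  show "rule_step H (insert t H)" if "{t1, t2} \<subseteq> H" for H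
    using that by (intro assms(3)) auto
qed (use assms(1,2) in auto)

lemma reach_step3:
  assumes "reach G t1" "reach G t2" "reach G t3"
    and "\<And>H. t1 \<in> H \<Longrightarrow> t2 \<in> H \<Longrightarrow> t3 \<in> H \<Longrightarrow> rule_step H (insert t H)"
  shows "reach G t"
proof (rule reach_step)
  show "rule_step H (insert t H)" if "{t1, t2, t3} \<subseteq> H" for H
    using that by (intro assms(4)) auto
qed (use assms(1,2,3) in auto)

text \<open>If \<open>q\<close> is not a URI reference, no graph contains the triple; two reachable
  triples that would yield it by one subproperty step stand in for it.\<close>

definition gen_reach ::
  "('u, 'b, 'l, 'a::annotation_domain) ann_graph \<Rightarrow> ('u, 'b, 'l) gen_triple \<Rightarrow> 'a \<Rightarrow> bool" where
  "gen_reach G = (\<lambda>(X, q, Y) v.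
    case q of URI p \<Rightarrow> reach G ((X, p, Y), v)
    | _ \<Rightarrow> \<exists>D v1 v2. reach G ((URI D, Sp, q), v1) \<and> reach G ((X, D, Y), v2) \<and> v = v1 * v2)"

lemma gen_reach_URI [simp]: "gen_reach G (X, URI p, Y) v \<longleftrightarrow> reach G ((X, p, Y), v)"
  by (simp add: gen_reach_def)

lemma gen_reach_non_URI:
  "q \<notin> range URI \<Longrightarrow> gen_reach G (X, q, Y) v \<longleftrightarrow>
    (\<exists>D v1 v2. reach G ((URI D, Sp, q), v1) \<and> reach G ((X, D, Y), v2) \<and> v = v1 * v2)"
  by (auto simp: gen_reach_def split: rdf_term.split)

section \<open>From generalized to proper derivations\<close>

lemma gen_reach_sp:
  assumes "reach G ((URI D, Sp, E), v1)" "reach G ((X, D, Y), v2)" "v1 * v2 \<noteq> 0"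
  shows "gen_reach G (X, E, Y) (v1 * v2)"
proof (cases "E \<in> range URI")
  case True
  then obtain p where "E = URI p" by blast
  with assms show ?thesis by (auto intro: reach_step2 rule_2b)
next
  case False
  with assms show ?thesis by (auto simp: gen_reach_non_URI)
qed

text \<open>If the predicate \<open>D\<close> of the second premise is not a URI reference, that
  premise is given by \<open>(URI D', Sp, D)\<close> and \<open>(X, D', Y)\<close>. A further
  subproperty step is absorbed by rule 2a, and a domain or range step is exactly rule 5.\<close>

lemma gen_rule_reach:
  assumes "gen_rule t1 t2 t" "gen_reach G t1 v1" "gen_reach G t2 v2" "v1 * v2 \<noteq> 0"
  shows "gen_reach G t (v1 * v2)"
  using assms
proof cases
  case (sp_trans A B C)
  with assms show ?thesis by (auto intro: reach_step2 rule_2a)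
next
  case (sp D E X Y)
  show ?thesis
  proof (cases "D \<in> range URI")
    case True
    with assms sp show ?thesis by (auto intro: gen_reach_sp)
  next
    case False
    with assms(3) sp obtain D' w1 w2 where D':
      "reach G ((URI D', Sp, D), w1)" "reach G ((X, D', Y), w2)" "v2 = w1 * w2"
      by (auto simp: gen_reach_non_URI)
    \<comment> \<open>Regrouped so that the two subproperty annotations are combined first.\<close>
    have eq: "v1 * v2 = (w1 * v1) * w2" by (simp add: D'(3) ac_simps)
    with assms(4) have "w1 * v1 \<noteq> 0" by auto
    then have "reach G ((URI D', Sp, E), w1 * v1)"
      using D'(1) assms(2) sp by (auto intro: reach_step2 rule_2a)
    from gen_reach_sp[OF this D'(2)] assms(4) show ?thesis
      unfolding eq sp by simp
  qed
next
  case (sc_trans A B C)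
  with assms show ?thesis by (auto intro: reach_step2 rule_3a)
next
  case (sc A B X)
  with assms show ?thesis by (auto intro: reach_step2 rule_3b)
next
  case (dom D B X Y)
  show ?thesis
  proof (cases "D \<in> range URI")
    case True
    with assms dom show ?thesis by (auto intro: reach_step2 rule_4a)
  next
    case False
    with assms(3) dom obtain D' w1 w2 where D':
      "reach G ((URI D', Sp, D), w1)" "reach G ((X, D', Y), w2)" "v2 = w1 * w2"
      by (auto simp: gen_reach_non_URI)
    with dom assms(2,4) show ?thesis
      by (auto intro: reach_step3 rule_5a simp flip: mult.assoc)
  qed
next
  case (range D B X Y)
  show ?thesis
  proof (cases "D \<in> range URI")
    case True
    with assms range show ?thesis by (auto intro: reach_step2 rule_4b)
  next
    case False
    with assms(3) range obtain D' w1 w2 where D':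
      "reach G ((URI D', Sp, D), w1)" "reach G ((X, D', Y), w2)" "v2 = w1 * w2"
      by (auto simp: gen_reach_non_URI)
    with range assms(2,4) show ?thesis
      by (auto intro: reach_step3 rule_5b simp flip: mult.assoc)
  qed
qed

text \<open>Rules are not applied when the result is 0. A nonzero product has nonzero factors, so
  \<open>v \<noteq> 0\<close> is inherited by the premises.\<close>

lemma simple_deriv_gen_reach:
  assumes "simple_deriv U gen_rule (gen_graph G) F t v" "v \<noteq> 0"
  shows "gen_reach G t v"
  using assms
proof (induction rule: simple_deriv.induct)
  case (base t v F)
  then show ?case by (cases t) (auto simp: gen_graph_iff intro: reach_mem)
next
  case (step t1 t2 t F v1 v2)
  then have "v1 \<noteq> 0" "v2 \<noteq> 0" by auto
  with step show ?case by (blast intro: gen_rule_reach)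
qed

text \<open>Replacing two annotations by their sum, as the destructive rule 6 does, shrinks
  \<open>V\<close> and keeps the total until one annotation is left.\<close>

lemma derives_sum:
  fixes V :: "'a::annotation_domain set"
  assumes "finite V" "V \<noteq> {}" "0 \<notin> V"
  shows "{t} \<times> V \<turnstile> {(t, \<Sum>V)}"
  using assms
proof (induction "card V" arbitrary: V rule: less_induct)
  case less
  from less.prems(2) obtain v where v: "v \<in> V" by blast
  show ?case
  proof (cases "V = {v}")
    case True
    then show ?thesis by (simp add: derives_refl)
  next
    case False
    with v obtain w where w: "w \<in> V" "w \<noteq> v" by blast
    define W where "W = V - {v, w}"
    have V: "V = insert v (insert w W)" using v w by (auto simp: W_def)
    have fin: "finite W" using less.prems(1) by (simp add: W_def)
    have "card V = Suc (Suc (card W))"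
      using w fin unfolding V by (simp add: W_def)
    \<comment> \<open>Only a bound: \<open>v + w\<close> may already lie in
      \<open>W\<close>.\<close>
    moreover have "card (insert (v + w) W) \<le> Suc (card W)"
      by (rule card_insert_le_m1) simp_all
    ultimately have "card (insert (v + w) W) < card V" by simp
    moreover have nz: "v + w \<noteq> 0"
      using ann_le_add1[of v w] v less.prems(3) by auto
    ultimately have IH: "{t} \<times> insert (v + w) W \<turnstile> {(t, \<Sum>(insert (v + w) W))}"
      using less.prems(3) fin by (intro less.hyps) (auto simp: W_def)
    have "\<Sum>(insert (v + w) W) = \<Sum>V"
      using fin unfolding V by (simp add: sum_insert_idem ac_simps)
    moreover have "rule_step ({t} \<times> V) ({t} \<times> insert (v + w) W)"
    proof -
      obtain X A Y where t: "t = (X, A, Y)" by (cases t)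
      \<comment> \<open>Deletion precedes insertion, so this also holds when \<open>v + w\<close> is
        \<open>v\<close> or \<open>w\<close>.\<close>
      have "{t} \<times> insert (v + w) W = insert (t, v + w) ({t} \<times> V - {(t, v), (t, w)})"
        by (auto simp: W_def)
      then show ?thesis
        using rule_6[of X A Y v "{t} \<times> V" w] v w nz by (simp add: t)
    qed
    ultimately show ?thesis
      using derives_trans[OF derives_step IH] by simp
  qed
qed

lemma derives_deriv_sum:
  assumes "finite U" "finite G" "deriv_sum U gen_rule (gen_graph G) (s, URI p, v) \<noteq> 0"
  shows "G \<turnstile> {((s, p, v), deriv_sum U gen_rule (gen_graph G) (s, URI p, v))}"
proof -
  let ?V = "{w. simple_deriv U gen_rule (gen_graph G) {} (s, URI p, v) w}"
  have "finite (gen_graph G)" using assms(2) by (simp add: gen_graph_def)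
  then have fin: "finite ?V" using assms(1) by (simp add: finite_simple_deriv)
  \<comment> \<open>The value 0 may occur but is no annotation; dropping it leaves the sum
    unchanged.\<close>
  have sum_eq: "\<Sum>(?V - {0}) = deriv_sum U gen_rule (gen_graph G) (s, URI p, v)"
    unfolding deriv_sum_def using fin by (intro sum.mono_neutral_left) auto
  then have ne: "?V - {0} \<noteq> {}"
    using assms(3) by (metis sum.empty)
  have "reach G t" if "t \<in> {(s, p, v)} \<times> (?V - {0})" for t
    using that simple_deriv_gen_reach by fastforce
  with fin obtain H where H: "G \<turnstile> H" "{(s, p, v)} \<times> (?V - {0}) \<subseteq> H"
    using reach_finite[of "{(s, p, v)} \<times> (?V - {0})" G G] by auto
  \<comment> \<open>Rule 1b discards all other triples, so that merging ends in a singleton.\<close>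
  have "G \<turnstile> {(s, p, v)} \<times> (?V - {0})"
    using derives_trans[OF H(1) derives_step[OF rule_1b[OF H(2)]]] .
  moreover have "{(s, p, v)} \<times> (?V - {0}) \<turnstile> {((s, p, v), \<Sum>(?V - {0}))}"
    using ne fin by (intro derives_sum) auto
  ultimately show ?thesis
    unfolding sum_eq by (rule derives_trans)
qed


section \<open>Completeness\<close>

text \<open>\<open>\<mu>\<close> grounds with fresh URI references and \<open>\<nu>\<close> undoes
  this on \<open>S\<close>. Literals stay fixed under \<open>\<nu>\<close> because plain literals
  must denote themselves.\<close>

lemma skolemization:
  fixes S :: "('u::infinite, 'b, 'l) rdf_term set"
  assumes "finite S"
  obtains \<mu> \<nu> :: "('u, 'b, 'l) rdf_term \<Rightarrow> ('u, 'b, 'l) rdf_term"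
  where "rdf_map \<mu>" "range \<mu> \<inter> range Blank = {}" "\<And>t. t \<in> S \<Longrightarrow> \<nu> (\<mu> t) = t"
    "\<And>l. \<nu> (Literal l) = Literal l"
proof -
  define B where "B = {b. Blank b \<in> S}"
  define W where "W = {u. URI (Ref u) \<in> S}"
  have "B = Blank -` S" "W = (URI \<circ> Ref) -` S"
    by (auto simp: B_def W_def)
  then have fin: "finite B" "finite W"
    using assms by (auto intro!: finite_vimageI simp: inj_def)
  then have "infinite (UNIV - W)"
    by (simp add: infinite_UNIV)
  \<comment> \<open>The fresh names: as many as there are blank nodes in \<open>S\<close>, and none
    of them used in \<open>S\<close>.\<close>
  then obtain C where C: "finite C" "card C = card B" "C \<subseteq> UNIV - W"
    using infinite_arbitrarily_large by metis
  then obtain f where f: "bij_betw f B C"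
    using finite_same_card_bij[OF fin(1) C(1)] by metis
  \<comment> \<open>Blank nodes outside \<open>S\<close> go to \<open>Sp\<close>, an arbitrary
    ground term.\<close>
  define \<mu> :: "('u, 'b, 'l) rdf_term \<Rightarrow> ('u, 'b, 'l) rdf_term" where
    "\<mu> = (\<lambda>t. case t of Blank b \<Rightarrow> URI (if b \<in> B then Ref (f b) else Sp) | _ \<Rightarrow> t)"
  define \<nu> :: "('u, 'b, 'l) rdf_term \<Rightarrow> ('u, 'b, 'l) rdf_term" where
    "\<nu> = (\<lambda>t. case t of URI (Ref u) \<Rightarrow> if u \<in> C then Blank (inv_into B f u) else t | _ \<Rightarrow> t)"
  show thesis
  proof (rule that)
    show "rdf_map \<mu>" "range \<mu> \<inter> range Blank = {}"
      by (auto simp: rdf_map_def \<mu>_def split: rdf_term.splits)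
    show "\<nu> (Literal l) = Literal l" for l
      by (simp add: \<nu>_def)
    fix t assume t: "t \<in> S"
    show "\<nu> (\<mu> t) = t"
    proof (cases t)
      case (Blank b)
      with t have b: "b \<in> B" by (simp add: B_def)
      then have "f b \<in> C" "inv_into B f (f b) = b"
        using f by (auto simp: bij_betw_def)
      with b show ?thesis by (simp add: Blank \<mu>_def \<nu>_def)
    next
      case (URI u)
      with t C(3) show ?thesis by (cases u) (auto simp: \<mu>_def \<nu>_def W_def)
    qed (simp add: \<mu>_def \<nu>_def)
  qed
qed

text \<open>Denoting by \<open>\<nu>\<close> lets a fresh URI reference stand for the blank node it
  replaces. All elements are resources, properties and classes at once, so the domains prescribed by
  Typing II all become \<open>R \<times> R\<close>.\<close>

definition canonical ::
  "('u, 'b, 'l) rdf_term set \<Rightarrow> (('u, 'b, 'l) rdf_term \<Rightarrow> ('u, 'b, 'l) rdf_term) \<Rightarrow>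
    (('u, 'b, 'l) gen_triple \<Rightarrow> 'a) \<Rightarrow> ('u, 'b, 'l, 'd, 'a) interp" where
  "canonical V \<nu> val = (let R = Inl ` \<nu> ` V in
    \<lparr>voc = V, Delta_R = R, Delta_P = R, Delta_C = R, Delta_L = R,
     P_ext = (\<lambda>p (x, y). if p \<in> R \<and> x \<in> R \<and> y \<in> R
       then Some (val (projl x, projl p, projl y)) else None),
     C_ext = (\<lambda>c x. if c \<in> R \<and> x \<in> R then Some (val (projl x, URI Typ, projl c)) else None),
     den = Inl \<circ> \<nu>\<rparr>)"

lemma opt_le_otimesI:
  assumes "\<And>a b. X = Some a \<Longrightarrow> Y = Some b \<Longrightarrow> \<exists>c. Z = Some c \<and> a * b \<preceq> c"
  shows "X \<otimes> Y \<lesssim> Z"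
  using assms by (auto simp: opt_le_def opt_otimes_def split: option.splits)

text \<open>A valuation only has to dominate the graph and be closed under the generalized rules:
  each inequality of a model is a rule instance, up to commuting factors.\<close>

lemma canonical_model:
  fixes val :: "('u, 'b, 'l) gen_triple \<Rightarrow> 'a::annotation_domain"
  assumes "finite V" "rho_df \<subseteq> V" "universe K \<subseteq> V"
    and rho: "\<And>t. t \<in> rho_df \<Longrightarrow> \<nu> t = t"
    and lit: "\<And>l. \<nu> (Literal l) = Literal l"
    and base: "\<And>s p v a. ((s, p, v), a) \<in> K \<Longrightarrow> a \<preceq> val (\<nu> s, \<nu> (URI p), \<nu> v)"
    and step: "\<And>t1 t2 s p v. gen_rule t1 t2 (s, p, v) \<Longrightarrow> {s, p, v} \<subseteq> \<nu> ` V \<Longrightarrow>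
      val t1 * val t2 \<preceq> val (s, p, v)"
  shows "model plain (canonical V \<nu> val :: ('u, 'b, 'l, 'd, 'a) interp) K"
proof -
  define R :: "('u, 'b, 'l, 'd) resource set" where "R = Inl ` \<nu> ` V"
  define I where "I = (canonical V \<nu> val :: ('u, 'b, 'l, 'd, 'a) interp)"
  have I: "voc I = V" "Delta_R I = R" "Delta_P I = R" "Delta_C I = R" "Delta_L I = R"
    "den I t = Inl (\<nu> t)"
    "P_ext I p (x, y) = (if p \<in> R \<and> x \<in> R \<and> y \<in> R
       then Some (val (projl x, projl p, projl y)) else None)"
    "C_ext I c x = (if c \<in> R \<and> x \<in> R then Some (val (projl x, URI Typ, projl c)) else None)"
    for t p x y c
    by (simp_all add: I_def canonical_def R_def Let_def)
  have rhoI: "URI e \<in> V" "\<nu> (URI e) = URI e" "Inl (URI e) \<in> R"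
    if "e \<in> {Sp, Sc, Typ, Dom, Rng}" for e
  proof -
    have *: "URI e \<in> rho_df" using that by (auto simp: rho_df_def)
    with assms(2) rho show "URI e \<in> V" "\<nu> (URI e) = URI e" by auto
    then show "Inl (URI e) \<in> R" unfolding R_def by (metis imageI)
  qed
  have den_in: "den I t \<in> R" if "t \<in> V" for t
    using that by (simp add: I R_def)
  have P_uri: "P_uri I e (x, y) =
      (if x \<in> R \<and> y \<in> R then Some (val (projl x, URI e, projl y)) else None)"
    if "e \<in> {Sp, Sc, Typ, Dom, Rng}" for e x y
    using rhoI[OF that] by (simp add: I)
  have dom_P: "dom (P_ext I p) = (if p \<in> R then R \<times> R else {})" for p
    by (auto simp: I dom_def split: if_splits)
  have dom_P_uri: "dom (P_uri I e) = R \<times> R" if "e \<in> {Sp, Sc, Typ, Dom, Rng}" for e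
    using rhoI[OF that] by (simp add: dom_P I)
  have dom_C: "dom (C_ext I c) = (if c \<in> R then R else {})" for c
    by (auto simp: I dom_def)
  have P_ext_SomeD: "p \<in> R \<and> x \<in> R \<and> y \<in> R \<and> a = val (projl x, projl p, projl y)"
    if "P_ext I p (x, y) = Some a" for p x y a
    using that by (simp add: I(7) split: if_splits)
  have projl_R: "projl x \<in> \<nu> ` V" if "x \<in> R" for x
    using that by (auto simp: R_def)
  have e_R: "URI e \<in> \<nu> ` V" if "e \<in> {Sp, Sc, Typ, Dom, Rng}" for e
    using projl_R[OF rhoI(3)[OF that]] by simp
  have "interpretation_wf plain I"
  proof -
    have "R \<noteq> {}" using rhoI(3)[of Sp] by auto
    moreover have "finite R" using assms(1) by (simp add: R_def)
    moreover have "P_ext I p = Map.empty" if "p \<notin> R" for p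
      using dom_P[of p] that by simp
    moreover have "C_ext I c = Map.empty" if "c \<notin> R" for c
      using dom_C[of c] that by simp
    moreover have "Inl (Literal l) \<in> R" if "Literal l \<in> V" for l
      using den_in[OF that] by (simp add: I lit)
    ultimately show ?thesis
      unfolding interpretation_wf_def using den_in by (simp add: I(1-6) dom_P dom_C lit)
  qed
  moreover have "sat_simple I K"
    unfolding sat_simple_def
  proof (intro allI impI conjI)
    fix s p v a assume *: "((s, p, v), a) \<in> K"
    then have "s \<in> V" "URI p \<in> V" "v \<in> V"
      using assms(3) by (force simp: universe_def)+
    from this[THEN den_in] show "den I (URI p) \<in> Delta_P I"
      "Some a \<lesssim> P_uri I p (den I s, den I v)"
      using base[OF *] by (simp_all add: I opt_le_def)
  qed
  moreover have "sat_subproperty I"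
    unfolding sat_subproperty_def
  proof (intro conjI allI opt_le_otimesI)
    fix p q r a b
    assume "P_uri I Sp (p, q) = Some a" "P_uri I Sp (q, r) = Some b"
    then show "\<exists>c. P_uri I Sp (p, r) = Some c \<and> a * b \<preceq> c"
      using step[OF gen_rule.sp_trans] by (auto simp: P_uri projl_R e_R split: if_splits)
  next
    fix p q x y a b
    assume "P_ext I p (x, y) = Some a" "P_uri I Sp (p, q) = Some b"
    then show "\<exists>c. P_ext I q (x, y) = Some c \<and> a * b \<preceq> c"
      using step[OF gen_rule.sp, of "projl x" "projl q" "projl y" "projl p"] P_ext_SomeD[of p x y a]
        I(7)[of q x y]
      by (auto simp: P_uri projl_R mult.commute split: if_splits)
  qed
  moreover have "sat_subclass I"
    unfolding sat_subclass_def
  proof (intro conjI allI opt_le_otimesI)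
    fix c d e a b
    assume "P_uri I Sc (c, d) = Some a" "P_uri I Sc (d, e) = Some b"
    then show "\<exists>z. P_uri I Sc (c, e) = Some z \<and> a * b \<preceq> z"
      using step[OF gen_rule.sc_trans] by (auto simp: P_uri projl_R e_R split: if_splits)
  next
    fix c d x a b
    assume "C_ext I c x = Some a" "P_uri I Sc (c, d) = Some b"
    then show "\<exists>z. C_ext I d x = Some z \<and> a * b \<preceq> z"
      using step[OF gen_rule.sc]
      by (auto simp: P_uri I(8) projl_R e_R mult.commute[of a] split: if_splits)
  qed
  moreover have "sat_typing1 I"
    unfolding sat_typing1_def
  proof (intro conjI ballI allI opt_le_otimesI)
    fix c x assume "c \<in> Delta_C I" "x \<in> Delta_R I"
    then show "C_ext I c x = P_uri I Typ (x, c)"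
      by (simp add: P_uri I(2,4,8))
  next
    fix p c x y a b
    assume "P_uri I Dom (p, c) = Some a" "P_ext I p (x, y) = Some b"
    then show "\<exists>z. C_ext I c x = Some z \<and> a * b \<preceq> z"
      using step[OF gen_rule.dom, of "projl x" "projl c" "projl p" "projl y"] P_ext_SomeD[of p x y b]
      by (auto simp: P_uri I(8) projl_R e_R split: if_splits)
  next
    fix p c x y a b
    assume "P_uri I Rng (p, c) = Some a" "P_ext I p (x, y) = Some b"
    then show "\<exists>z. C_ext I c y = Some z \<and> a * b \<preceq> z"
      using step[OF gen_rule.range, of "projl y" "projl c" "projl p" "projl x"] P_ext_SomeD[of p x y b]
      by (auto simp: P_uri I(8) projl_R e_R split: if_splits)
  qed
  moreover have "sat_typing2 I"
  proof -
    have "den I t \<in> R" if "t \<in> rho_df" for t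
      using that assms(2) den_in by blast
    then show ?thesis
      unfolding sat_typing2_def by (simp add: dom_P_uri I(2-4))
  qed
  ultimately show ?thesis
    using assms(2,3) unfolding model_def I_def[symmetric] by (simp add: I(1))
qed

lemma finite_universe: "finite G \<Longrightarrow> finite (universe G)"
  by (auto simp: universe_def)

theorem derives_complete:
  fixes G :: "('u::infinite, 'b, 'l, 'a::annotation_domain) ann_graph"
  assumes fin: "finite G" and "a \<noteq> 0"
    and ent: "entails TYPE('d) plain G {((x, p, y), a)}"
  shows "\<exists>a'. a \<preceq> a' \<and> G \<turnstile> {((x, p, y), a')}"
proof -
  \<comment> \<open>The target triple is included so that the fresh names avoid its URI references
    as well.\<close>
  define S where "S = rho_df \<union> universe G \<union> universe {((x, p, y), a)}"
  have "finite S"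
    using fin by (simp add: S_def finite_universe rho_df_def)
  then obtain \<mu> \<nu> :: "('u, 'b, 'l) rdf_term \<Rightarrow> ('u, 'b, 'l) rdf_term"
    where \<mu>: "rdf_map \<mu>" "range \<mu> \<inter> range Blank = {}"
      and \<nu>: "\<And>t. t \<in> S \<Longrightarrow> \<nu> (\<mu> t) = t" "\<And>l. \<nu> (Literal l) = Literal l"
    by (rule skolemization) blast
  have \<nu>_S: "\<nu> t = t" if "t \<in> S" "t \<notin> range Blank" for t
    using \<nu>(1)[OF that(1)] \<mu>(1) that(2) by (simp add: rdf_map_def)
  define G' where "G' = map_graph \<mu> G"
  have univ': "universe G' = \<mu> ` universe G"
    by (simp add: G'_def universe_map_graph[OF \<mu>(1)])
  then have "grounding G' G"
    using \<mu> by (auto simp: grounding_def ground_def G'_def)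
  then obtain H' where "grounding H' {((x, p, y), a)}" and H'_ent: "ground_entails TYPE('d) plain G' H'"
    using ent unfolding entails_def by blast
  then obtain \<kappa> where \<kappa>: "rdf_map \<kappa>" and H': "H' = {((\<kappa> x, p, \<kappa> y), a)}"
    by (auto simp: grounding_def map_graph_def)
  \<comment> \<open>The grounding \<open>\<kappa>\<close> comes from the entailment and may use
    terms outside \<open>S\<close>; they join the vocabulary because the entailment speaks only of
    interpretations covering \<open>H'\<close>.\<close>
  define V where "V = rho_df \<union> universe G' \<union> universe H'"
  define U where "U = \<nu> ` V \<times> \<nu> ` V \<times> \<nu> ` V"
  define val where "val = deriv_sum U gen_rule (gen_graph G)"
  have finV: "finite V"
    using fin by (simp add: V_def univ' H' finite_universe rho_df_def)
  then have finU: "finite U" by (simp add: U_def)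
  have fin_gen: "finite (gen_graph G)" using fin by (simp add: gen_graph_def)
  have rho: "\<nu> t = t" if "t \<in> rho_df" for t
    using that by (intro \<nu>_S) (auto simp: S_def rho_df_def)
  have univ_V: "t \<in> \<nu> ` V" if "t \<in> universe G" for t
    using that \<nu>(1)[of t] unfolding V_def univ' S_def by force
  have "model plain (canonical V \<nu> val :: ('u, 'b, 'l, 'd, 'a) interp) G'"
  proof (rule canonical_model)
    fix s q v b assume "((s, q, v), b) \<in> G'"
    then obtain s0 v0 where *: "((s0, q, v0), b) \<in> G" "s = \<mu> s0" "v = \<mu> v0"
      by (auto simp: G'_def map_graph_def)
    then have in_G: "s0 \<in> universe G" "URI q \<in> universe G" "v0 \<in> universe G"
      by (force simp: universe_def)+
    \<comment> \<open>\<open>\<nu>\<close> undoes the grounding, so values are computed from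
      derivations over \<open>G\<close> itself rather than \<open>G'\<close>.\<close>
    then have eq: "(\<nu> s, \<nu> (URI q), \<nu> v) = (s0, URI q, v0)"
      using \<nu>(1) \<nu>_S[of "URI q"] by (auto simp: * S_def)
    have "((s0, URI q, v0), b) \<in> gen_graph G"
      using *(1) by (simp add: gen_graph_iff)
    then show "b \<preceq> val (\<nu> s, \<nu> (URI q), \<nu> v)"
      unfolding eq val_def using in_G[THEN univ_V]
      by (intro deriv_sum_base[OF finU fin_gen]) (auto simp: U_def)
  next
    fix t1 t2 s q v
    assume "gen_rule t1 t2 (s, q, v)" "{s, q, v} \<subseteq> \<nu> ` V"
    then show "val t1 * val t2 \<preceq> val (s, q, v)"
      unfolding val_def by (intro deriv_sum_step[OF finU fin_gen]) (auto simp: U_def)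
  qed (use finV rho \<nu>(2) in \<open>auto simp: V_def\<close>)
  then have "model plain (canonical V \<nu> val :: ('u, 'b, 'l, 'd, 'a) interp) H'"
    using H'_ent unfolding ground_entails_def by (simp add: canonical_def V_def Let_def)
  then have "sat_simple (canonical V \<nu> val :: ('u, 'b, 'l, 'd, 'a) interp) H'"
    by (simp add: model_def)
  moreover have in_V: "\<kappa> x \<in> V" "URI p \<in> V" "\<kappa> y \<in> V"
    by (simp_all add: V_def H' universe_def)
  moreover have \<nu>_p: "\<nu> (URI p) = URI p"
    by (intro \<nu>_S) (auto simp: S_def universe_def)
  moreover have "URI p \<in> \<nu> ` V"
    using imageI[OF in_V(2), of \<nu>] by (simp only: \<nu>_p)
  ultimately have le: "a \<preceq> val (\<nu> (\<kappa> x), URI p, \<nu> (\<kappa> y))"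
    using \<open>a \<noteq> 0\<close> by (simp add: sat_simple_def H' canonical_def opt_le_def Let_def)
  define a' where "a' = val (\<nu> (\<kappa> x), URI p, \<nu> (\<kappa> y))"
  have "a' \<noteq> 0" using le \<open>a \<noteq> 0\<close> by (auto simp: a'_def)
  then have "G \<turnstile> {((\<nu> (\<kappa> x), p, \<nu> (\<kappa> y)), a')}"
    unfolding a'_def val_def by (intro derives_deriv_sum finU fin)
  also have "{((\<nu> (\<kappa> x), p, \<nu> (\<kappa> y)), a')} \<turnstile> {((x, p, y), a')}"
  proof (intro derives_step rule_1a)
    \<comment> \<open>Rule 1a needs a map, but \<open>\<nu> \<circ> \<kappa>\<close> may move fresh
      URI references. Restricting it to blank nodes changes nothing on \<open>S\<close>, whose
      ground terms are fixed by both functions.\<close>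
    define \<rho> where "\<rho> t = (if t \<in> range Blank then \<nu> (\<kappa> t) else t)" for t
    show "annotated_graph {((x, p, y), a')}"
      using \<open>a' \<noteq> 0\<close> by (simp add: annotated_graph_def annotated_triple_def)
    show "rdf_map \<rho>" by (simp add: rdf_map_def \<rho>_def)
    have "\<rho> t = \<nu> (\<kappa> t)" if "t \<in> S" for t
      using \<nu>_S[OF that] \<kappa> by (auto simp: \<rho>_def rdf_map_def)
    then have "\<rho> x = \<nu> (\<kappa> x)" "\<rho> y = \<nu> (\<kappa> y)"
      by (simp_all add: S_def universe_def)
    then show "map_graph \<rho> {((x, p, y), a')} \<subseteq> {((\<nu> (\<kappa> x), p, \<nu> (\<kappa> y)), a')}"
      by (simp add: map_graph_def)
  qed
  finally (derives_trans) show ?thesis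
    using le unfolding a'_def by blast
qed

theorem proposition3p2:
  fixes G :: "('u::infinite, 'b::infinite, 'l::infinite, 'a::annotation_domain) ann_graph"
    and \<tau> :: "('u, 'b, 'l) triple" and a :: 'a and plain :: "'l set"
  assumes "annotated_graph G" and "annotated_triple (\<tau>, a)"
  shows "(G \<turnstile> {(\<tau>, a)} \<longrightarrow> entails TYPE('d) plain G {(\<tau>, a)}) \<and>
    (entails TYPE('d) plain G {(\<tau>, a)} \<longrightarrow> (\<exists>a'. a \<preceq> a' \<and> G \<turnstile> {(\<tau>, a')}))"
proof (intro conjI impI)
  assume "G \<turnstile> {(\<tau>, a)}"
  then show "entails TYPE('d) plain G {(\<tau>, a)}" by (rule derives_sound)
next
  assume ent: "entails TYPE('d) plain G {(\<tau>, a)}"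
  obtain x p y where \<tau>: "\<tau> = (x, p, y)" by (cases \<tau>)
  have "finite G" "a \<noteq> 0"
    using assms by (simp_all add: annotated_graph_def annotated_triple_def)
  from derives_complete[OF this ent[unfolded \<tau>]]
  show "\<exists>a'. a \<preceq> a' \<and> G \<turnstile> {(\<tau>, a')}" by (simp add: \<tau>)
qed

end
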